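(* Let $n>2$. If $L$ is a canonical $n$-lattice, then $L'$ is canonical.
   Context: An $n$-poset ($n\ge2$) is a finite poset whose $n$ elements are labelled $0,1,\ldots,n-1$, where $0$ is the least element and $1$ is the greatest element; an $n$-lattice is an $n$-poset that is a lattice. For $a\in L$, $\mathrm{cov}_L(a)$ is the set of elements covering $a$. The depth $\mathrm{dep}_L(a)$ is the integer $p$ such that $p+1$ is the maximum number of elements of a chain in $L$ with least element $a$ and greatest element $1$. $\mathrm{lev}_k(L)=\{a:\mathrm{dep}_L(a)=k\}$. $L$ is levellised if $\mathrm{dep}_L(i)\le\mathrm{dep}_L(j)$ whenever $0<i\le j<n$. $\mathrm{wt}(A)=\sum_{j\in A}2^j$; $\mathrm{cov}^d_L(i)=\mathrm{cov}_L(i)\cap\mathrm{lev}_d(L)$. For a levellised $n$-lattice $L$ with $n>2$ and $k=\mathrm{dep}_L(n-1)$, $L'$ is the subposet of $L$ induced by all elements of depth $\neq k$ (i.e. $L$ with its last non-trivial level removed); it is an $n'$-lattice with labels $0,\ldots,n'-1$ for some $n'<n$. The relation $<$ on levellised $n$-lattices isomorphic as unlabelled lattices is defined by induction on $n$ (trivial for $n=2$): $L_1<L_2$ iff either $L_1'<L_2'$, or $L_1'=L_2'$ and, with $k=\mathrm{dep}_{L_1}(n-1)=\mathrm{dep}_{L_2}(n-1)$ and $\mathrm{lev}_k(L_1)=\mathrm{lev}_k(L_2)=\{a_k,\ldots,n-1\}$, there exist $\ell\in\{1,\ldots,k-1\}$ and $i\in\{a_k,\ldots,n-1\}$ with $\mathrm{wt}(\mathrm{cov}^d_{L_1}(j))=\mathrm{wt}(\mathrm{cov}^d_{L_2}(j))$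 whenever $d>\ell$, or $d=\ell$ and $j\in\{a_k,\ldots,i-1\}$, and $\mathrm{wt}(\mathrm{cov}^\ell_{L_1}(i))<\mathrm{wt}(\mathrm{cov}^\ell_{L_2}(i))$. An $n$-lattice $L$ is canonical if it is levellised and $<$-minimal among all levellised $n$-lattices isomorphic to $L$ as unlabelled lattices. *)

theory Defs
  imports "HOL-Algebra.Lattice"
begin

text \<open>
  A poset on the labels \<open>0, \<dots>, n - 1\<close> is its reflexive order relation, a set of pairs over
  \<open>{..<n}\<close>; thus equality of relations is equality of labelled posets.
\<close>

definition n_poset :: "nat \<Rightarrow> nat rel \<Rightarrow> bool" where
  "n_poset n L \<longleftrightarrow>
     2 \<le> n \<and> partial_order_on {..<n} L \<and> (\<forall>x<n. (0, x) \<in> L \<and> (x, 1) \<in> L)"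

definition gorder_of :: "nat \<Rightarrow> nat rel \<Rightarrow> nat gorder" where
  "gorder_of n L = \<lparr>carrier = {..<n}, eq = (=), le = (\<lambda>x y. (x, y) \<in> L)\<rparr>"

definition n_lattice :: "nat \<Rightarrow> nat rel \<Rightarrow> bool" where
  "n_lattice n L \<longleftrightarrow> n_poset n L \<and> Lattice.lattice (gorder_of n L)"

definition cov :: "nat rel \<Rightarrow> nat \<Rightarrow> nat set" where
  "cov L a = {b. (a, b) \<in> L \<and> a \<noteq> b \<and> \<not> (\<exists>c. c \<noteq> a \<and> c \<noteq> b \<and> (a, c) \<in> L \<and> (c, b) \<in> L)}"

definition dep :: "nat rel \<Rightarrow> nat \<Rightarrow> nat" where
  "dep L a =
     Max {card C |C. C \<in> Chains L \<and> a \<in> C \<and> 1 \<in> C \<and> (\<forall>x\<in>C. (a, x) \<in> L \<and> (x, 1) \<in> L)} - 1"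

definition lev :: "nat \<Rightarrow> nat rel \<Rightarrow> nat \<Rightarrow> nat set" where
  "lev n L k = {a \<in> {..<n}. dep L a = k}"

definition levellised :: "nat \<Rightarrow> nat rel \<Rightarrow> bool" where
  "levellised n L \<longleftrightarrow> (\<forall>i j. 0 < i \<and> i \<le> j \<and> j < n \<longrightarrow> dep L i \<le> dep L j)"

definition wt :: "nat set \<Rightarrow> nat" where
  "wt A = (\<Sum>j\<in>A. 2 ^ j)"

definition cov_lev :: "nat \<Rightarrow> nat rel \<Rightarrow> nat \<Rightarrow> nat \<Rightarrow> nat set" where
  "cov_lev n L d i = cov L i \<inter> lev n L d"

definition isomorphic :: "nat \<Rightarrow> nat rel \<Rightarrow> nat rel \<Rightarrow> bool" where
  "isomorphic n L1 L2 \<longleftrightarrow>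
     (\<exists>f. bij_betw f {..<n} {..<n} \<and>
          (\<forall>x<n. \<forall>y<n. (x, y) \<in> L1 \<longleftrightarrow> (f x, f y) \<in> L2))"

text \<open>
  \<open>L'\<close> and its number \<open>n'\<close> of elements. For a levellised lattice with \<open>n > 2\<close> the elements that
  are kept are exactly the labels \<open>0, \<dots>, n' - 1\<close>, so no relabelling is needed.
\<close>

definition kept :: "nat \<Rightarrow> nat rel \<Rightarrow> nat set" where
  "kept n L = {..<n} - lev n L (dep L (n - 1))"

definition trunc_size :: "nat \<Rightarrow> nat rel \<Rightarrow> nat" where
  "trunc_size n L = card (kept n L)"

definition trunc :: "nat \<Rightarrow> nat rel \<Rightarrow> nat rel" where
  "trunc n L = L \<inter> (kept n L \<times> kept n L)"

lemma trunc_size_less: "2 < n \<Longrightarrow> trunc_size n L < n"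
proof -
  assume "2 < n"
  then have "n - 1 \<in> {..<n} - kept n L"
    by (auto simp: kept_def lev_def)
  then have "kept n L \<subset> {..<n}"
    by (auto simp: kept_def)
  then have "card (kept n L) < card {..<n}"
    by (intro psubset_card_mono) auto
  then show ?thesis
    by (simp add: trunc_size_def)
qed

declare conj_cong [fundef_cong]

text \<open>
  The first conjuncts of the right-hand side restrict the relation to its domain: isomorphic
  levellised \<open>n\<close>-lattices (for \<open>n = 2\<close> there is only one, and the relation is empty). On this
  domain both truncations have the same size, and the last levels and their depths coincide.
\<close>

function lat_less :: "nat \<Rightarrow> nat rel \<Rightarrow> nat rel \<Rightarrow> bool" where
  "lat_less n L1 L2 \<longleftrightarrow>
     2 < n \<and> n_lattice n L1 \<and> n_lattice n L2 \<and> levellised n L1 \<and> levellised n L2 \<and>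
       isomorphic n L1 L2 \<and>
     (lat_less (trunc_size n L1) (trunc n L1) (trunc n L2) \<or>
      trunc n L1 = trunc n L2 \<and>
      (\<exists>k a. k = dep L1 (n - 1) \<and> k = dep L2 (n - 1) \<and>
         lev n L1 k = {a..n - 1} \<and> lev n L2 k = {a..n - 1} \<and>
         (\<exists>l\<in>{1..<k}. \<exists>i\<in>{a..n - 1}.
            (\<forall>d>l. \<forall>j\<in>{a..n - 1}. wt (cov_lev n L1 d j) = wt (cov_lev n L2 d j)) \<and>
            (\<forall>j\<in>{a..<i}. wt (cov_lev n L1 l j) = wt (cov_lev n L2 l j)) \<and>
            wt (cov_lev n L1 l i) < wt (cov_lev n L2 l i))))"
  by pat_completeness auto
termination
  by (relation "measure (\<lambda>(n, L1, L2). n)") (auto simp: trunc_size_less)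

declare lat_less.simps [simp del]
declare conj_cong [fundef_cong del]

definition canonical :: "nat \<Rightarrow> nat rel \<Rightarrow> bool" where
  "canonical n L \<longleftrightarrow>
     n_lattice n L \<and> levellised n L \<and>
     \<not> (\<exists>M. n_lattice n M \<and> levellised n M \<and> isomorphic n M L \<and> lat_less n M L)"

end

theory Submission
  imports Defs
begin

text \<open>
  A levellised lattice below \<open>L'\<close> and isomorphic to it is extended to a lattice isomorphic to \<open>L\<close>
  by extending the isomorphism with the identity on the last level of \<open>L\<close> and pulling back the
  order. Truncating the extension gives back the smaller lattice, so the extension lies below
  \<open>L\<close>, by the first alternative in the definition of the order.
\<close>

section \<open>Lattices as relations\<close>

lemma n_poset_iff:
  "n_poset n L \<longleftrightarrow> 2 \<le> n \<and> L \<subseteq> {..<n} \<times> {..<n} \<and> (\<forall>x<n. (x, x) \<in> L) \<and> trans L \<and> antisym L \<and>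
     (\<forall>x<n. (0, x) \<in> L \<and> (x, 1) \<in> L)"
  unfolding n_poset_def partial_order_on_def preorder_on_def refl_on_def by auto

text \<open>Unpacks the record-based lattice notion once, so that later arguments use only binary
  suprema and infima with respect to \<open>L\<close>.\<close>

lemma n_lattice_iff:
  "n_lattice n L \<longleftrightarrow> n_poset n L \<and>
     (\<forall>x<n. \<forall>y<n.
        (\<exists>s<n. (x, s) \<in> L \<and> (y, s) \<in> L \<and> (\<forall>u<n. (x, u) \<in> L \<and> (y, u) \<in> L \<longrightarrow> (s, u) \<in> L)) \<and>
        (\<exists>m<n. (m, x) \<in> L \<and> (m, y) \<in> L \<and> (\<forall>u<n. (u, x) \<in> L \<and> (u, y) \<in> L \<longrightarrow> (u, m) \<in> L)))"
    (is "_ \<longleftrightarrow> _ \<and> (\<forall>x<n. \<forall>y<n. ?sup x y \<and> ?inf x y)")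
proof (cases "n_poset n L")
  case True
  let ?G = "gorder_of n L"
  have po: "Order.partial_order ?G"
    using True unfolding n_poset_iff gorder_of_def
    by unfold_locales (auto dest: transD antisymD)
  have sup: "(\<exists>s. least ?G s (Upper ?G {x, y})) \<longleftrightarrow> ?sup x y" if "x < n" "y < n" for x y
    using that by (auto simp: gorder_of_def least_def Upper_def)
  have inf: "(\<exists>s. greatest ?G s (Lower ?G {x, y})) \<longleftrightarrow> ?inf x y" if "x < n" "y < n" for x y
    using that by (auto simp: gorder_of_def greatest_def Lower_def)
  have carrier: "carrier ?G = {..<n}"
    by (simp add: gorder_of_def)
  have "Lattice.lattice ?G \<longleftrightarrow> (\<forall>x<n. \<forall>y<n. ?sup x y \<and> ?inf x y)"
    using po sup inf carrier
    unfolding Lattice.lattice_def upper_semilattice_def lower_semilattice_def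
      upper_semilattice_axioms_def lower_semilattice_axioms_def by auto
  with True show ?thesis
    by (simp add: n_lattice_def)
qed (simp add: n_lattice_def)

lemma n_lattice_poset: "n_lattice n L \<Longrightarrow> n_poset n L"
  by (simp add: n_lattice_def)

lemma n_lattice_supE:
  assumes "n_lattice n L" "x < n" "y < n"
  obtains s where "s < n" "(x, s) \<in> L" "(y, s) \<in> L"
    "\<And>u. u < n \<Longrightarrow> (x, u) \<in> L \<Longrightarrow> (y, u) \<in> L \<Longrightarrow> (s, u) \<in> L"
proof -
  have "\<exists>s<n. (x, s) \<in> L \<and> (y, s) \<in> L \<and> (\<forall>u<n. (x, u) \<in> L \<and> (y, u) \<in> L \<longrightarrow> (s, u) \<in> L)"
    using assms by (simp add: n_lattice_iff)
  then show thesis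
    using that by blast
qed

lemma n_lattice_infE:
  assumes "n_lattice n L" "x < n" "y < n"
  obtains m where "m < n" "(m, x) \<in> L" "(m, y) \<in> L"
    "\<And>u. u < n \<Longrightarrow> (u, x) \<in> L \<Longrightarrow> (u, y) \<in> L \<Longrightarrow> (u, m) \<in> L"
proof -
  have "\<exists>m<n. (m, x) \<in> L \<and> (m, y) \<in> L \<and> (\<forall>u<n. (u, x) \<in> L \<and> (u, y) \<in> L \<longrightarrow> (u, m) \<in> L)"
    using assms by (simp add: n_lattice_iff)
  then show thesis
    using that by blast
qed

text \<open>The relabelling of \<open>L\<close> along \<open>f\<close>: for a permutation
  \<open>f\<close> of \<open>{..<n}\<close>, \<open>f\<close> is by construction an isomorphism onto
  \<open>L\<close>. The bounds matter because \<open>f\<close> is unconstrained outside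
  \<open>{..<n}\<close>.\<close>

definition pullback :: "nat \<Rightarrow> (nat \<Rightarrow> nat) \<Rightarrow> nat rel \<Rightarrow> nat rel" where
  "pullback n f L = {(x, y). x < n \<and> y < n \<and> (f x, f y) \<in> L}"

lemma n_lattice_pullback:
  assumes L: "n_lattice n L" and f: "bij_betw f {..<n} {..<n}" and "f 0 = 0" "f 1 = 1"
  shows "n_lattice n (pullback n f L)"
proof -
  have po: "n_poset n L"
    using L by (rule n_lattice_poset)
  have lt: "f x < n" if "x < n" for x
    using bij_betwE[OF f] that by auto
  have inj: "x = y" if "f x = f y" "x < n" "y < n" for x y
    using bij_betw_imp_inj_on[OF f] that by (auto dest: inj_onD)
  have surj: "\<exists>x<n. f x = z" if "z < n" for z
  proof -
    have "z \<in> f ` {..<n}"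
      using that by (simp add: bij_betw_imp_surj_on[OF f])
    then show ?thesis
      by blast
  qed
  have "n_poset n (pullback n f L)"
    unfolding n_poset_iff
  proof (intro conjI)
    show "trans (pullback n f L)"
      using po by (auto intro!: transI simp: n_poset_iff pullback_def dest: transD)
    show "antisym (pullback n f L)"
    proof (rule antisymI)
      fix x y assume "(x, y) \<in> pullback n f L" "(y, x) \<in> pullback n f L"
      then have "(f x, f y) \<in> L" "(f y, f x) \<in> L" "x < n" "y < n"
        by (auto simp: pullback_def)
      moreover have "antisym L"
        using po by (simp add: n_poset_iff)
      ultimately show "x = y"
        by (meson antisymD inj)
    qed
  qed (use po lt assms(3,4) in \<open>auto simp: n_poset_iff pullback_def\<close>)
  \<comment> \<open>All elements are written as images under \<open>f\<close>, which is the supremum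
    condition for the pullback; surjectivity supplies a preimage of the supremum in
    \<open>L\<close>.\<close>
  moreover have "\<exists>s<n. (f x, f s) \<in> L \<and> (f y, f s) \<in> L \<and>
         (\<forall>u<n. (f x, f u) \<in> L \<and> (f y, f u) \<in> L \<longrightarrow> (f s, f u) \<in> L)"
    if "x < n" "y < n" for x y
  proof -
    obtain s where "s < n" "(f x, s) \<in> L" "(f y, s) \<in> L"
        "\<And>u. u < n \<Longrightarrow> (f x, u) \<in> L \<Longrightarrow> (f y, u) \<in> L \<Longrightarrow> (s, u) \<in> L"
      using n_lattice_supE[OF L lt lt] \<open>x < n\<close> \<open>y < n\<close> by blast
    then show ?thesis
      using surj[of s] lt by blast
  qed
  moreover have "\<exists>m<n. (f m, f x) \<in> L \<and> (f m, f y) \<in> L \<and>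
         (\<forall>u<n. (f u, f x) \<in> L \<and> (f u, f y) \<in> L \<longrightarrow> (f u, f m) \<in> L)"
    if "x < n" "y < n" for x y
  proof -
    obtain m where "m < n" "(m, f x) \<in> L" "(m, f y) \<in> L"
        "\<And>u. u < n \<Longrightarrow> (u, f x) \<in> L \<Longrightarrow> (u, f y) \<in> L \<Longrightarrow> (u, m) \<in> L"
      using n_lattice_infE[OF L lt lt] \<open>x < n\<close> \<open>y < n\<close> by blast
    then show ?thesis
      using surj[of m] lt by blast
  qed
  ultimately show ?thesis
    unfolding n_lattice_iff by (simp add: pullback_def cong: conj_cong)
qed

text \<open>Isomorphisms preserve the least and the greatest element, and these carry the prescribed
  labels \<open>0\<close> and \<open>1\<close>.\<close>

lemma n_poset_iso_fixes:
  assumes "n_poset n L1" "n_poset n L2" and f: "bij_betw f {..<n} {..<n}"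
    and iso: "\<forall>x<n. \<forall>y<n. (x, y) \<in> L1 \<longleftrightarrow> (f x, f y) \<in> L2"
  shows "f 0 = 0" "f 1 = 1"
proof -
  have n: "0 < n" "1 < n"
    using assms(1) by (auto simp: n_poset_iff)
  have "0 \<in> f ` {..<n}" "1 \<in> f ` {..<n}"
    using n by (simp_all add: bij_betw_imp_surj_on[OF f])
  then obtain a b where "a < n" "f a = 0" "b < n" "f b = 1"
    by (auto simp: image_iff)
  then have "(f 0, 0) \<in> L2" "(1, f 1) \<in> L2"
    using iso n assms(1) unfolding n_poset_iff by metis+
  moreover have "(0, f 0) \<in> L2" "(f 1, 1) \<in> L2"
    using bij_betwE[OF f] n assms(2) by (auto simp: n_poset_iff)
  ultimately show "f 0 = 0" "f 1 = 1"
    using assms(2) unfolding n_poset_iff antisym_def by metis+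
qed

section \<open>Depth\<close>

text \<open>The chains over which \<open>dep\<close> maximises, named so that depths can be compared
  by comparing families of chains.\<close>

definition chains_to_top :: "nat rel \<Rightarrow> nat \<Rightarrow> nat set set" where
  "chains_to_top L a =
     {C. C \<in> Chains L \<and> a \<in> C \<and> 1 \<in> C \<and> (\<forall>x\<in>C. (a, x) \<in> L \<and> (x, 1) \<in> L)}"

lemma dep_alt: "dep L a = Max (card ` chains_to_top L a) - 1"
  unfolding dep_def chains_to_top_def by (rule arg_cong[where f = "\<lambda>S. Max S - 1"]) auto

lemma chains_to_top_subset:
  assumes "n_poset n L" "C \<in> chains_to_top L a"
  shows "C \<subseteq> {..<n}"
  using assms by (auto simp: n_poset_iff chains_to_top_def)

text \<open>Adding \<open>x\<close> at the bottom of a longest chain from \<open>y\<close> to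
  \<open>1\<close> gives a longer chain from \<open>x\<close>.\<close>

lemma dep_less:
  assumes L: "n_poset n L" and "(x, y) \<in> L" "x \<noteq> y"
  shows "dep L y < dep L x"
proof -
  have fin: "finite (chains_to_top L a)" for a
    using chains_to_top_subset[OF L]
    by (meson finite_Pow_iff finite_lessThan finite_subset PowI subsetI)
  have xy: "x < n" "y < n"
    using assms by (auto simp: n_poset_iff)
  have ne: "{y, 1} \<in> chains_to_top L y"
    using L xy by (auto simp: n_poset_iff chains_to_top_def Chains_def)
  have "Max (card ` chains_to_top L y) \<in> card ` chains_to_top L y"
    using fin ne by (intro Max_in) auto
  then obtain C where C: "C \<in> chains_to_top L y" "card C = Max (card ` chains_to_top L y)"
    by auto
  have "finite C"
    using chains_to_top_subset[OF L C(1)] finite_subset by blast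
  have "x \<notin> C"
    using L C(1) assms by (auto simp: n_poset_iff chains_to_top_def dest: antisymD)
  have up: "(x, c) \<in> L" if "c \<in> C" for c
    using L C(1) assms that by (auto simp: n_poset_iff chains_to_top_def dest: transD)
  have "insert x C \<in> chains_to_top L x"
    using C(1) up L xy by (auto simp: n_poset_iff chains_to_top_def Chains_def)
  then have "card (insert x C) \<le> Max (card ` chains_to_top L x)"
    using fin by auto
  \<comment> \<open>Strictness has to survive the truncated subtraction of 1 in
    \<open>dep\<close>.\<close>
  moreover have "card C > 0"
    using \<open>finite C\<close> C(1) by (auto simp: chains_to_top_def card_gt_0_iff)
  ultimately show ?thesis
    using \<open>finite C\<close> \<open>x \<notin> C\<close> C(2) by (simp add: dep_alt)
qed

text \<open>Taking images under \<open>f\<close> maps the chains from \<open>a\<close> to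
  \<open>1\<close> onto those from \<open>f a\<close> to \<open>f 1 = 1\<close>, and injectivity
  preserves their cardinalities.\<close>

lemma dep_pullback:
  assumes L: "n_poset n L" and f: "bij_betw f {..<n} {..<n}" and f1: "f 1 = 1" and "a < n"
  shows "dep (pullback n f L) a = dep L (f a)"
proof -
  let ?M = "pullback n f L"
  have one: "1 < n"
    using L by (simp add: n_poset_iff)
  have inj: "inj_on f {..<n}"
    using f by (simp add: bij_betw_def)
  have "chains_to_top L (f a) = image f ` chains_to_top ?M a"
  proof (intro equalityI subsetI)
    fix D assume D: "D \<in> chains_to_top L (f a)"
    define C where "C = {x \<in> {..<n}. f x \<in> D}"
    have "D = f ` C"
    proof -
      have "D \<subseteq> f ` {..<n}"
        using chains_to_top_subset[OF L D] by (simp add: bij_betw_imp_surj_on[OF f])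
      then show ?thesis
        by (auto simp: C_def)
    qed
    moreover have "C \<in> chains_to_top ?M a"
      using D f1 one \<open>a < n\<close> by (auto simp: C_def chains_to_top_def Chains_def pullback_def)
    ultimately show "D \<in> image f ` chains_to_top ?M a"
      by blast
  next
    fix D assume "D \<in> image f ` chains_to_top ?M a"
    then show "D \<in> chains_to_top L (f a)"
      using f1 by (force simp: chains_to_top_def Chains_def pullback_def)
  qed
  moreover have "card (f ` C) = card C" if "C \<in> chains_to_top ?M a" for C
    using that by (intro card_image inj_on_subset[OF inj])
      (auto simp: chains_to_top_def pullback_def)
  ultimately have "card ` chains_to_top L (f a) = card ` chains_to_top ?M a"
    by (simp add: image_image)
  then show ?thesis
    by (simp add: dep_alt)
qed

section \<open>Truncation\<close>

lemma kept_iff: "x \<in> kept n L \<longleftrightarrow> x < n \<and> dep L x \<noteq> dep L (n - 1)"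
  by (auto simp: kept_def lev_def)

lemma levellised_dep_le_last:
  "levellised n L \<Longrightarrow> 0 < i \<Longrightarrow> i < n \<Longrightarrow> dep L i \<le> dep L (n - 1)"
  by (simp add: levellised_def)

text \<open>For \<open>n > 2\<close> the label \<open>n - 1\<close> lies strictly between
  \<open>0\<close> and \<open>1\<close>, so its depth differs from both of theirs.\<close>

lemma bounds_kept:
  assumes "n_poset n L" "2 < n"
  shows "0 \<in> kept n L" "1 \<in> kept n L"
proof -
  have "(0, n - 1) \<in> L" "(n - 1, 1) \<in> L"
    using assms by (auto simp: n_poset_iff)
  then have "dep L (n - 1) < dep L 0" "dep L 1 < dep L (n - 1)"
    using assms by (auto intro!: dep_less[OF assms(1)])
  then show "0 \<in> kept n L" "1 \<in> kept n L"
    using assms(2) by (simp_all add: kept_iff)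
qed

text \<open>The kept labels are closed under passing to smaller labels: a nonzero smaller label has
  no greater depth, and \<open>0\<close>, about which \<open>levellised\<close> says nothing, is
  kept anyway.\<close>

lemma kept_eq:
  assumes "n_poset n L" "levellised n L" "2 < n"
  shows "kept n L = {..<trunc_size n L}"
proof -
  have down: "i \<in> kept n L" if "j \<in> kept n L" "i \<le> j" for i j
  proof (cases "i = 0")
    case False
    with that assms(2) have "dep L i \<le> dep L j" "dep L j \<le> dep L (n - 1)"
      by (auto simp: levellised_def kept_iff)
    with that show ?thesis
      by (auto simp: kept_iff)
  qed (use bounds_kept assms in auto)
  have fin: "finite (kept n L)"
    by (simp add: kept_def)
  define m where "m = Max (kept n L)"
  have "m \<in> kept n L"
    unfolding m_def using fin bounds_kept[OF assms(1,3)] by (intro Max_in) auto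
  moreover have "x \<le> m" if "x \<in> kept n L" for x
    using that fin by (simp add: m_def)
  ultimately have "kept n L = {..<Suc m}"
    by (auto simp: less_Suc_eq_le intro: down[of m])
  then show ?thesis
    by (simp add: trunc_size_def)
qed

text \<open>A kept nonzero element has depth below that of \<open>n - 1\<close>, and moving up only
  lowers the depth. The element \<open>0\<close> is exceptional, as it also lies below the last
  level.\<close>

lemma kept_up:
  assumes "n_poset n L" "levellised n L" "x \<in> kept n L" "0 < x" "(x, y) \<in> L"
  shows "y \<in> kept n L"
proof (cases "x = y")
  case False
  then have "dep L y < dep L x"
    using assms dep_less by blast
  moreover have "dep L x \<le> dep L (n - 1)"
    using assms by (intro levellised_dep_le_last) (auto simp: kept_iff)
  ultimately show ?thesis
    using assms by (auto simp: kept_iff n_poset_iff)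
qed (use assms in simp)

text \<open>By \<open>kept_up\<close>, no chain from \<open>x\<close> to \<open>1\<close> meets the
  last level. Chains starting at \<open>0\<close> may meet it.\<close>

lemma dep_trunc:
  assumes "n_poset n L" "levellised n L" "x \<in> kept n L" "0 < x"
  shows "dep (trunc n L) x = dep L x"
proof -
  have "chains_to_top (trunc n L) x = chains_to_top L x"
    using kept_up[OF assms] by (auto simp: chains_to_top_def Chains_def trunc_def)
  then show ?thesis
    by (simp add: dep_alt)
qed

lemma levellised_trunc:
  assumes "n_poset n L" "levellised n L" "2 < n"
  shows "levellised (trunc_size n L) (trunc n L)"
  unfolding levellised_def
proof (intro allI impI, elim conjE)
  fix i j :: nat assume ij: "0 < i" "i \<le> j" "j < trunc_size n L"
  then have kept: "i \<in> kept n L" "j \<in> kept n L"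
    using kept_eq[OF assms] by auto
  then have "dep L i \<le> dep L j"
    using assms ij by (simp add: levellised_def kept_iff)
  then show "dep (trunc n L) i \<le> dep (trunc n L) j"
    using kept ij assms by (simp add: dep_trunc)
qed

text \<open>Suprema of kept elements are kept, since the nonzero kept elements are closed upwards;
  infima may be lost and then have to be replaced.\<close>

lemma n_lattice_trunc:
  assumes L: "n_lattice n L" and lev: "levellised n L" and n: "2 < n"
  shows "n_lattice (trunc_size n L) (trunc n L)"
proof -
  note po = n_lattice_poset[OF L]
  let ?k = "trunc_size n L" and ?K = "kept n L" and ?T = "trunc n L"
  have K: "x < ?k \<longleftrightarrow> x \<in> ?K" for x
    using kept_eq[OF po lev n] by auto
  have Kn: "x < n" if "x \<in> ?K" for x
    using that by (simp add: kept_iff)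
  note b = bounds_kept[OF po n]
  have T: "(x, y) \<in> ?T \<longleftrightarrow> (x, y) \<in> L \<and> x \<in> ?K \<and> y \<in> ?K" for x y
    by (auto simp: trunc_def)
  have "2 \<le> ?k"
    using b(2) K[of 1] by simp
  have poT: "n_poset ?k ?T"
    unfolding n_poset_iff
  proof (intro conjI)
    show "trans ?T"
      using po unfolding n_poset_iff trans_def T by blast
    show "antisym ?T"
      using po unfolding n_poset_iff antisym_def T by blast
  qed (use po b Kn \<open>2 \<le> ?k\<close> in \<open>auto simp: n_poset_iff T K\<close>)
  have zero: "x = 0" if "(x, 0) \<in> L" for x
    using po that unfolding n_poset_iff antisym_def by blast
  show ?thesis
    unfolding n_lattice_iff
  proof (intro conjI allI impI poT)
    fix x y assume "x < ?k" "y < ?k"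
    then have xy: "x \<in> ?K" "y \<in> ?K" "x < n" "y < n"
      using K Kn by auto
    obtain s where s: "s < n" "(x, s) \<in> L" "(y, s) \<in> L"
        "\<And>u. u < n \<Longrightarrow> (x, u) \<in> L \<Longrightarrow> (y, u) \<in> L \<Longrightarrow> (s, u) \<in> L"
      using n_lattice_supE[OF L xy(3,4)] by blast
    have "s \<in> ?K"
    \<comment> \<open>\<open>kept_up\<close> needs a nonzero element below \<open>s\<close>; if both
      are \<open>0\<close>, then \<open>s\<close> is \<open>0\<close> itself.\<close>
    proof (cases "x = 0 \<and> y = 0")
      case True
      then have "(s, 0) \<in> L"
        using s(4)[of 0] po n by (auto simp: n_poset_iff)
      then show ?thesis
        using zero[of s] b by simp
    next
      case False
      then show ?thesis
        using kept_up[OF po lev] xy s by (metis neq0_conv)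
    qed
    then show "\<exists>s<?k. (x, s) \<in> ?T \<and> (y, s) \<in> ?T \<and>
        (\<forall>u<?k. (x, u) \<in> ?T \<and> (y, u) \<in> ?T \<longrightarrow> (s, u) \<in> ?T)"
      using s xy Kn unfolding K T by blast
    obtain m where m: "m < n" "(m, x) \<in> L" "(m, y) \<in> L"
        "\<And>u. u < n \<Longrightarrow> (u, x) \<in> L \<Longrightarrow> (u, y) \<in> L \<Longrightarrow> (u, m) \<in> L"
      using n_lattice_infE[OF L xy(3,4)] by blast
    show "\<exists>m<?k. (m, x) \<in> ?T \<and> (m, y) \<in> ?T \<and>
        (\<forall>u<?k. (u, x) \<in> ?T \<and> (u, y) \<in> ?T \<longrightarrow> (u, m) \<in> ?T)"
    proof (cases "m \<in> ?K")
      case True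
      then show ?thesis
        using m xy Kn unfolding K T by blast
    next
      case False
      \<comment> \<open>Only \<open>0\<close> lies below an element of the last level, so the meet becomes \<open>0\<close>.\<close>
      have "u = 0" if "u \<in> ?K" "(u, x) \<in> L" "(u, y) \<in> L" for u
        using kept_up[OF po lev that(1)] m(4)[OF Kn[OF that(1)] that(2,3)] False by auto
      moreover have "(0, x) \<in> L" "(0, y) \<in> L" "(0, 0) \<in> L"
        using po xy n by (auto simp: n_poset_iff)
      ultimately show ?thesis
        using b xy unfolding K T by blast
    qed
  qed
qed

section \<open>Extending a rearrangement of the truncation\<close>

text \<open>As the last level keeps its labels, \<open>n - 1\<close> keeps its depth and truncation
  removes the same labels from \<open>N\<close> as from \<open>L\<close>.\<close>

lemma extend_trunc:
  assumes L: "n_lattice n L" and lev: "levellised n L" and n: "2 < n"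
    and M: "n_lattice (trunc_size n L) M" "levellised (trunc_size n L) M"
    and iso: "isomorphic (trunc_size n L) M (trunc n L)"
  obtains N where "n_lattice n N" "levellised n N" "isomorphic n N L"
    "trunc_size n N = trunc_size n L" "trunc n N = M"
proof -
  let ?k = "trunc_size n L"
  note po = n_lattice_poset[OF L]
  have K: "kept n L = {..<?k}"
    by (rule kept_eq[OF po lev n])
  have kn: "?k < n"
    using n by (rule trunc_size_less)
  obtain f where f: "bij_betw f {..<?k} {..<?k}"
    and fiso: "\<forall>x<?k. \<forall>y<?k. (x, y) \<in> M \<longleftrightarrow> (f x, f y) \<in> trunc n L"
    using iso unfolding isomorphic_def by blast
  have poM: "n_poset ?k M"
    using M(1) by (rule n_lattice_poset)
  have f01: "f 0 = 0" "f 1 = 1"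
    using n_poset_iso_fixes[OF poM n_lattice_poset[OF n_lattice_trunc[OF L lev n]] f fiso] .
  have k2: "2 \<le> ?k"
    using poM by (simp add: n_poset_iff)
  have f_lt: "f x < ?k" if "x < ?k" for x
    using bij_betwE[OF f] that by auto
  have f_pos: "0 < f x" if "x < ?k" "0 < x" for x
    using inj_onD[OF bij_betw_imp_inj_on[OF f], of x 0] that f01 by (auto intro: gr0I)
  define g where "g x = (if x < ?k then f x else x)" for x
  have "bij_betw g ({..<?k} \<union> {?k..<n}) ({..<?k} \<union> {?k..<n})"
  proof (rule bij_betw_combine)
    show "bij_betw g {..<?k} {..<?k}"
      using f by (subst bij_betw_cong[of _ g f]) (auto simp: g_def)
    show "bij_betw g {?k..<n} {?k..<n}"
      by (auto simp: g_def bij_betw_def inj_on_def image_iff)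
  qed auto
  moreover have "{..<?k} \<union> {?k..<n} = {..<n}"
    using kn by auto
  ultimately have g: "bij_betw g {..<n} {..<n}"
    by simp
  have g01: "g 0 = 0" "g 1 = 1"
    using f01 k2 by (auto simp: g_def)
  define N where "N = pullback n g L"
  have N: "n_lattice n N"
    unfolding N_def by (rule n_lattice_pullback[OF L g g01])
  have isoN: "isomorphic n N L"
    using g unfolding isomorphic_def N_def pullback_def by (intro exI[of _ g]) auto
  have depN: "dep N x = dep L (g x)" if "x < n" for x
    unfolding N_def by (rule dep_pullback[OF po g g01(2) that])
  \<comment> \<open>Since \<open>n - 1\<close> is not below \<open>?k\<close>, it is fixed; hence
    the depth that defines the last level is the same for \<open>N\<close> and
    \<open>L\<close>.\<close>
  have g_last: "g (n - 1) = n - 1"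
    using kn by (auto simp: g_def)
  have keptN: "kept n N = kept n L"
  proof -
    have "x \<in> kept n N \<longleftrightarrow> g x \<in> kept n L" if "x < n" for x
      using bij_betwE[OF g] that n g_last by (auto simp: kept_iff depN)
    moreover have "g x \<in> kept n L \<longleftrightarrow> x \<in> kept n L" for x
      unfolding K using f_lt by (auto simp: g_def)
    ultimately show ?thesis
      by (auto simp: kept_iff)
  qed
  then have sz: "trunc_size n N = ?k"
    by (simp add: trunc_size_def)
  have truncN: "trunc n N = M"
  proof -
    have "(x, y) \<in> trunc n N \<longleftrightarrow> (x, y) \<in> M" for x y
    proof (cases "x < ?k \<and> y < ?k")
      case True
      then have "(x, y) \<in> trunc n N \<longleftrightarrow> (f x, f y) \<in> trunc n L"
        using kn f_lt unfolding trunc_def keptN K by (auto simp: N_def pullback_def g_def)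
      with True fiso show ?thesis
        by blast
    next
      case False
      then show ?thesis
        using poM by (auto simp: trunc_def keptN K n_poset_iff)
    qed
    then show ?thesis
      by auto
  qed
  have levN: "levellised n N"
    unfolding levellised_def
  proof (intro allI impI, elim conjE)
    fix i j assume ij: "0 < i" "i \<le> j" "j < n"
    have gi: "0 < g i" "g i < n"
      using ij f_pos f_lt kn by (auto simp: g_def dest: f_lt)
    \<comment> \<open>If \<open>j < ?k\<close>, both depths agree with those in \<open>M\<close>,
      which is levellised; otherwise \<open>j\<close> lies in the last level, whose depth bounds
      that of every nonzero element.\<close>
    show "dep N i \<le> dep N j"
    proof (cases "j < ?k")
      case True
      \<comment> \<open>\<open>dep_trunc\<close> does not apply to \<open>N\<close>, which is not yet known to be levellised.\<close>
      have M_pull: "M = pullback ?k f (trunc n L)"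
        using fiso poM by (auto simp: pullback_def n_poset_iff)
      \<comment> \<open>The depth is carried from \<open>M\<close> along \<open>f\<close> to the
        truncation of \<open>L\<close>, from there to \<open>L\<close>, and back along
        \<open>g\<close> to \<open>N\<close>.\<close>
      have "dep N x = dep M x" if "0 < x" "x < ?k" for x
      proof -
        have "dep M x = dep (trunc n L) (f x)"
          unfolding M_pull
          by (rule dep_pullback[OF n_lattice_poset[OF n_lattice_trunc[OF L lev n]] f f01(2) that(2)])
        also have "\<dots> = dep L (f x)"
          using that f_lt f_pos K by (intro dep_trunc[OF po lev]) auto
        also have "\<dots> = dep N x"
          using that kn by (simp add: depN g_def)
        finally show ?thesis
          by simp
      qed
      with True ij M(2) show ?thesis
        by (simp add: levellised_def)
    next
      case False
      then have "j \<notin> kept n L"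
        by (simp add: K)
      with False ij have "dep N j = dep L (n - 1)"
        by (auto simp: depN g_def kept_iff)
      moreover have "dep N i = dep L (g i)"
        using ij depN by simp
      ultimately show ?thesis
        using levellised_dep_le_last[OF lev gi] by simp
    qed
  qed
  show thesis
    using that N levN isoN sz truncN by blast
qed

theorem theorem3p9:
  fixes n :: nat and L :: "nat rel"
  assumes "2 < n"
    and "canonical n L"
  shows "canonical (trunc_size n L) (trunc n L)"
proof -
  have L: "n_lattice n L" "levellised n L"
    and minimal: "\<And>N. n_lattice n N \<Longrightarrow> levellised n N \<Longrightarrow> isomorphic n N L \<Longrightarrow> \<not> lat_less n N L"
    using assms(2) by (auto simp: canonical_def)
  have "\<not> lat_less (trunc_size n L) M (trunc n L)"
    if M: "n_lattice (trunc_size n L) M" "levellised (trunc_size n L) M"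
      "isomorphic (trunc_size n L) M (trunc n L)" for M
  proof
    assume less: "lat_less (trunc_size n L) M (trunc n L)"
    obtain N where N: "n_lattice n N" "levellised n N" "isomorphic n N L"
      "trunc_size n N = trunc_size n L" "trunc n N = M"
      using extend_trunc[OF L assms(1) M] by blast
    \<comment> \<open>The recursive call takes its size from the first argument, so the equality of
      truncation sizes is needed besides \<open>trunc n N = M\<close>.\<close>
    have "lat_less n N L"
      using N L assms(1) less by (subst lat_less.simps) simp
    with minimal N show False
      by blast
  qed
  moreover have "n_lattice (trunc_size n L) (trunc n L)"
    by (rule n_lattice_trunc[OF L assms(1)])
  moreover have "levellised (trunc_size n L) (trunc n L)"
    by (rule levellised_trunc[OF n_lattice_poset[OF L(1)] L(2) assms(1)])
  ultimately show ?thesis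
    unfolding canonical_def by blast
qed

end
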